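(* Let $Q(x)=1-bx+a_2x^2+a_3x^3+\cdots+a_nx^n$ with $b,a_2,\ldots,a_n\in\mathbb{Z}_{\ge0}$ and $Q(1)\le 0$ (i.e. the coefficients of $Q$ sum to at most $0$). Then there exists at least one planar upho poset $P$ whose rank-generating function is $Q(x)^{-1}$.
   Context: A poset $P$ is ranked if it has a disjoint decomposition $P=P_0\sqcup P_1\sqcup\cdots$ such that whenever $x\in P_i$ and $y$ covers $x$, then $y\in P_{i+1}$; it is of finite type if every $P_i$ is finite. The rank-generating function is $F_P(x)=\sum_{k\ge0}|P_k|x^k$. For $s\in P$, $V_{P,s}=\{t\in P:t\ge s\}$. A ranked poset $P$ is upho if it is of finite type and $V_{P,s}\cong P$ for all $s\in P$. A ranked poset is planar if it has a Hasse diagram in which every element of rank $i$ is drawn at $y$-coordinate $i$ and no two edges intersect. *)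

theory Defs
  imports
    "HOL-Analysis.Analysis"
    "HOL-Computational_Algebra.Computational_Algebra"
begin

text \<open>
  A poset is a carrier \<open>P\<close> with an order \<open>r\<close> such that \<open>partial_order_on P r\<close>, where
  \<open>(x, y) \<in> r\<close> means \<open>x \<le> y\<close>. A grading is the sequence \<open>R\<close> of its rank levels.
\<close>

definition covers :: "'a rel \<Rightarrow> 'a \<Rightarrow> 'a \<Rightarrow> bool" where
  "covers r y x \<longleftrightarrow> (x, y) \<in> r \<and> x \<noteq> y \<and>
     \<not> (\<exists>z. (x, z) \<in> r \<and> (z, y) \<in> r \<and> z \<noteq> x \<and> z \<noteq> y)"

text \<open>
  The last conjunct says that the order and the rank are compatible. The cover condition alone
  does not ensure this: an order without covers, such as the nonnegative rationals, would be
  ranked by every partition of its elements.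
\<close>

definition ranked_poset :: "'a set \<Rightarrow> 'a rel \<Rightarrow> (nat \<Rightarrow> 'a set) \<Rightarrow> bool" where
  "ranked_poset P r R \<longleftrightarrow>
     partial_order_on P r \<and>
     P = (\<Union>i. R i) \<and> disjoint_family R \<and>
     (\<forall>i x y. x \<in> R i \<and> covers r y x \<longrightarrow> y \<in> R (Suc i)) \<and>
     (\<forall>i j x y. x \<in> R i \<and> y \<in> R j \<and> (x, y) \<in> r \<and> x \<noteq> y \<longrightarrow> i < j)"

definition finite_type :: "(nat \<Rightarrow> 'a set) \<Rightarrow> bool" where
  "finite_type R \<longleftrightarrow> (\<forall>i. finite (R i))"

definition rank_gf :: "(nat \<Rightarrow> 'a set) \<Rightarrow> rat fps" where
  "rank_gf R = Abs_fps (\<lambda>k. of_nat (card (R k)))"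

definition poset_isomorphic :: "'a set \<Rightarrow> 'a rel \<Rightarrow> 'b set \<Rightarrow> 'b rel \<Rightarrow> bool" where
  "poset_isomorphic A r B s \<longleftrightarrow>
     (\<exists>f. bij_betw f A B \<and> (\<forall>x\<in>A. \<forall>y\<in>A. (x, y) \<in> r \<longleftrightarrow> (f x, f y) \<in> s))"

definition upho :: "'a set \<Rightarrow> 'a rel \<Rightarrow> (nat \<Rightarrow> 'a set) \<Rightarrow> bool" where
  "upho P r R \<longleftrightarrow>
     ranked_poset P r R \<and> finite_type R \<and>
     (\<forall>s\<in>P. poset_isomorphic (above r s) (Restr r (above r s)) P r)"

text \<open>
  Edges of the Hasse diagram are straight segments, and two different edges may share only a
  common endpoint. An edge joins consecutive integer heights, so it cannot pass through a
  third vertex.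
\<close>

definition planar :: "'a set \<Rightarrow> 'a rel \<Rightarrow> (nat \<Rightarrow> 'a set) \<Rightarrow> bool" where
  "planar P r R \<longleftrightarrow>
     (\<exists>pos :: 'a \<Rightarrow> real \<times> real.
        inj_on pos P \<and>
        (\<forall>i. \<forall>x\<in>R i. snd (pos x) = real i) \<and>
        (\<forall>x y x' y'. covers r y x \<and> covers r y' x' \<and> (x, y) \<noteq> (x', y') \<longrightarrow>
           closed_segment (pos x) (pos y) \<inter> closed_segment (pos x') (pos y')
             \<subseteq> {pos x, pos y} \<inter> {pos x', pos y'}))"

end

theory Submission
  imports Defs
begin

text \<open>
  Draw every rank as a row of points from left to right. Each point gets \<open>b\<close> upper covers,
  consecutive in the next row, and the \<open>b - 1\<close> gaps between these siblings receive fixed labels: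
  \<open>a\<^sub>i\<close> of them are labelled \<open>i - 1\<close>, the others are labelled \<open>0\<close>. A positive label \<open>l\<close> of a gap
  means that the right boundary of the cone above its left neighbour meets the left boundary of
  the cone above its right neighbour after \<open>l\<close> further ranks; the label \<open>0\<close> means that they never
  meet. Passing to the next row lowers a positive label by one, and a gap with label \<open>1\<close> makes
  the last child of its left neighbour coincide with the first child of its right neighbour.

  The drawing is planar by construction. The labels inside the cone above a point evolve
  independently of everything outside it, so every principal filter is a translated copy of the
  whole poset. Counting the gaps by label shows that the row sizes \<open>c\<close> satisfy
  \<open>c (m + 1) = b * c m - (\<Sum>i. a\<^sub>i * c (m + 1 - i))\<close>, which is the recurrence encoded by \<open>Q\<close>.
\<close>

section \<open>Rows of gap labels and the children of a point\<close>

text \<open>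
  A row is given by its label function \<open>w\<close>, where \<open>w i\<close> labels the gap between the points \<open>i\<close> and
  \<open>i + 1\<close>. A child shared by \<open>i\<close> and \<open>i + 1\<close> is attributed to \<open>i + 1\<close>.
\<close>

definition child_count :: "nat \<Rightarrow> (nat \<Rightarrow> nat) \<Rightarrow> nat \<Rightarrow> nat" where
  "child_count b w i = (if w i = 1 then b - 1 else b)"

definition first_child :: "nat \<Rightarrow> (nat \<Rightarrow> nat) \<Rightarrow> nat \<Rightarrow> nat" where
  "first_child b w i = (\<Sum>j<i. child_count b w j)"

text \<open>\<open>i\<close> is the point to which \<open>p\<close> is attributed. Position
  \<open>v\<close> = \<open>b - 1\<close> exists only if the label of \<open>i\<close> is not 1; the
  gap to its right then separates two families and carries the lowered label.\<close>

definition next_row :: "nat \<Rightarrow> (nat \<Rightarrow> nat) \<Rightarrow> (nat \<Rightarrow> nat) \<Rightarrow> nat \<Rightarrow> nat" where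
  "next_row b e w p =
     (let i = LEAST i. p < first_child b w (Suc i); v = p - first_child b w i
      in if v < b - 1 then e v else w i - 1)"

text \<open>
  Rows are infinite to the right: the row \<open>0\<close> consists of infinitely many roots that never
  interact, and the poset is the part above the root \<open>(0, 0)\<close>. The truncated subtraction in
  \<open>next_row\<close> keeps the label \<open>0\<close> constant.
\<close>

primrec row :: "nat \<Rightarrow> (nat \<Rightarrow> nat) \<Rightarrow> nat \<Rightarrow> nat \<Rightarrow> nat" where
  "row b e 0 = (\<lambda>_. 0)"
| "row b e (Suc k) = next_row b e (row b e k)"

text \<open>With \<open>b\<close> = 1 there are no sibling gaps, so no positive label ever arises.
  This keeps \<open>child_count\<close> positive, as a label 1 would make it 0.\<close>

lemma row_one: "row 1 e k i = 0"
  by (induction k arbitrary: i) (auto simp: next_row_def Let_def)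

locale gap_rows =
  fixes b :: nat and e :: "nat \<Rightarrow> nat"
  assumes b_pos: "b \<ge> 1"
begin

abbreviation w :: "nat \<Rightarrow> nat \<Rightarrow> nat" where "w \<equiv> row b e"
abbreviation S :: "nat \<Rightarrow> nat \<Rightarrow> nat" where "S k \<equiv> first_child b (w k)"
abbreviation len :: "nat \<Rightarrow> nat \<Rightarrow> nat" where "len k \<equiv> child_count b (w k)"

lemma S_0 [simp]: "S k 0 = 0"
  by (simp add: first_child_def)

lemma S_Suc: "S k (Suc i) = S k i + len k i"
  by (simp add: first_child_def)

lemma len_pos: "0 < len k i"
  using b_pos row_one[of e k i] by (cases "b = 1") (auto simp: child_count_def)

lemma len_le: "len k i \<le> b" and len_ge: "b - 1 \<le> len k i"
  by (auto simp: child_count_def)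

lemma strict_mono_S: "strict_mono (S k)"
  using len_pos by (auto simp: strict_mono_Suc_iff S_Suc)

lemma S_mono: "i \<le> j \<Longrightarrow> S k i \<le> S k j"
  using strict_mono_S by (simp add: strict_mono_less_eq)

lemma row_Suc_child:
  assumes "v < len k i"
  shows "w (Suc k) (S k i + v) = (if v < b - 1 then e v else w k i - 1)"
proof -
  have "(LEAST i'. S k i + v < S k (Suc i')) = i"
  proof (rule Least_equality)
    show "S k i + v < S k (Suc i)" using assms by (simp add: S_Suc)
  next
    fix y assume "S k i + v < S k (Suc y)"
    then have "S k i < S k (Suc y)" by simp
    then show "i \<le> y" using strict_mono_S[of k] by (simp add: strict_mono_less)
  qed
  then show ?thesis by (simp add: next_row_def Let_def)
qed

lemma split_index:
  obtains i v where "p = S k i + v" "v < len k i"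
proof -
  have "\<exists>i v. p = S k i + v \<and> v < len k i"
  proof (induction p)
    case 0
    then show ?case using len_pos[of k 0] by (intro exI[of _ 0]) simp
  next
    case (Suc p)
    then obtain i v where iv: "p = S k i + v" "v < len k i" by blast
    show ?case
    proof (cases "Suc v < len k i")
      case True
      then show ?thesis using iv by (intro exI[of _ i] exI[of _ "Suc v"]) simp
    next
      case False
      then have "Suc p = S k (Suc i) + 0" using iv by (simp add: S_Suc)
      then show ?thesis using len_pos by blast
    qed
  qed
  then show ?thesis using that by blast
qed

section \<open>Boundaries of cones\<close>

text \<open>\<open>lo\<close> and \<open>hi\<close> index the leftmost and rightmost descendants
  \<open>m\<close> ranks above point \<open>i\<close> of row \<open>k\<close>. The last child is
  \<open>S\<close> plus \<open>b - 1\<close> for every label: under label 1 it is the first child of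
  the right neighbour.\<close>

primrec lo :: "nat \<Rightarrow> nat \<Rightarrow> nat \<Rightarrow> nat" where
  "lo k i 0 = i"
| "lo k i (Suc m) = S (k + m) (lo k i m)"

primrec hi :: "nat \<Rightarrow> nat \<Rightarrow> nat \<Rightarrow> nat" where
  "hi k i 0 = i"
| "hi k i (Suc m) = S (k + m) (hi k i m) + (b - 1)"

lemma lo_root [simp]: "lo k 0 m = 0"
  by (induction m) auto

lemma lo_add: "lo k i (m + p) = lo (k + m) (lo k i m) p"
  by (induction p) (auto simp: add.assoc)

lemma hi_add: "hi k i (m + p) = hi (k + m) (hi k i m) p"
  by (induction p) (auto simp: add.assoc)

lemma lo_mono: "i \<le> j \<Longrightarrow> lo k i m \<le> lo k j m"
  by (induction m) (auto intro: S_mono)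

lemma hi_mono: "i \<le> j \<Longrightarrow> hi k i m \<le> hi k j m"
  by (induction m) (auto intro: S_mono)

lemma lo_le_hi: "lo k i m \<le> hi k i m"
  by (induction m) (auto intro: S_mono trans_le_add1)

lemma lo_Suc_le: "lo k (Suc i) m \<le> Suc (hi k i m)"
proof (induction m)
  case (Suc m)
  have "lo k (Suc i) (Suc m) \<le> S (k + m) (Suc (hi k i m))"
    using Suc S_mono by simp
  also have "\<dots> \<le> S (k + m) (hi k i m) + b"
    by (simp add: S_Suc len_le)
  finally show ?case using b_pos by simp
qed simp

text \<open>By \<open>lo_Suc_le\<close> neighbouring cones leave no index uncovered, so the cones
  above \<open>A\<close> to \<open>B\<close> together fill the whole interval.\<close>

lemma ex_between:
  assumes "A \<le> B" "lo k A m \<le> j" "j \<le> hi k B m"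
  shows "\<exists>i. A \<le> i \<and> i \<le> B \<and> lo k i m \<le> j \<and> j \<le> hi k i m"
  using assms
proof (induction B rule: dec_induct)
  case base
  then show ?case by auto
next
  case (step B)
  show ?case
  proof (cases "j \<le> hi k B m")
    case True
    then show ?thesis using step by (meson le_SucI)
  next
    case False
    then have "lo k (Suc B) m \<le> j" using lo_Suc_le[of k B m] by linarith
    then show ?thesis using step by (intro exI[of _ "Suc B"]) auto
  qed
qed

section \<open>The order and its covers\<close>

text \<open>The interval of descendants replaces a transitive closure of the child relation, so that
  isomorphisms reduce to translating boundaries.\<close>

definition le :: "nat \<times> nat \<Rightarrow> nat \<times> nat \<Rightarrow> bool" where
  "le x y \<longleftrightarrow> fst x \<le> fst y \<and> lo (fst x) (snd x) (fst y - fst x) \<le> snd y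
              \<and> snd y \<le> hi (fst x) (snd x) (fst y - fst x)"

lemma le_add [simp]: "le (k, i) (k + m, j) \<longleftrightarrow> lo k i m \<le> j \<and> j \<le> hi k i m"
  by (simp add: le_def)

lemma le_E:
  assumes "le (k, i) y"
  obtains m j where "y = (k + m, j)" "lo k i m \<le> j" "j \<le> hi k i m"
  using assms by (cases y) (auto simp: le_def intro!: that[of "fst y - k"])

lemma le_refl: "le x x"
  by (simp add: le_def)

lemma le_trans: assumes "le x y" "le y z" shows "le x z"
proof -
  obtain k i where x: "x = (k, i)" by (cases x)
  obtain m j where y: "y = (k + m, j)" "lo k i m \<le> j" "j \<le> hi k i m"
    using assms(1) x le_E by blast
  obtain p l where z: "z = (k + m + p, l)" "lo (k + m) j p \<le> l" "l \<le> hi (k + m) j p"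
    using assms(2) y le_E by blast
  have "le (k, i) (k + (m + p), l)"
    unfolding le_add lo_add hi_add
    using y z lo_mono[OF y(2), of "k + m" p] hi_mono[OF y(3), of "k + m" p] by linarith
  then show ?thesis using x z by (simp add: add.assoc)
qed

lemma le_same_rank: "le x y \<Longrightarrow> fst x = fst y \<Longrightarrow> x = y"
  by (auto simp: le_def prod_eq_iff)

lemma le_antisym: "le x y \<Longrightarrow> le y x \<Longrightarrow> x = y"
  by (rule le_same_rank) (auto simp: le_def)

lemma le_intermediate:
  assumes "le (k, i) (k + (m + p), j)"
  shows "\<exists>l. le (k, i) (k + m, l) \<and> le (k + m, l) (k + m + p, j)"
proof -
  have "lo k i m \<le> hi k i m" by (rule lo_le_hi)
  moreover have "lo (k + m) (lo k i m) p \<le> j" "j \<le> hi (k + m) (hi k i m) p"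
    using assms unfolding le_add lo_add hi_add by auto
  ultimately show ?thesis using ex_between by auto
qed

definition carrier :: "(nat \<times> nat) set" where
  "carrier = {x. le (0, 0) x}"

definition ord :: "(nat \<times> nat) rel" where
  "ord = {(x, y). x \<in> carrier \<and> le x y}"

definition level :: "nat \<Rightarrow> (nat \<times> nat) set" where
  "level m = {m} \<times> {..hi 0 0 m}"

lemma carrier_iff: "(m, t) \<in> carrier \<longleftrightarrow> t \<le> hi 0 0 m"
  by (simp add: carrier_def le_def)

lemma carrier_le: "x \<in> carrier \<Longrightarrow> le x y \<Longrightarrow> y \<in> carrier"
  using le_trans by (auto simp: carrier_def)

text \<open>By \<open>le_intermediate\<close> any element strictly above \<open>x\<close> lies
  weakly above some child of \<open>x\<close>, so a cover must be a child.\<close>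

lemma covers_E:
  assumes "covers ord y x"
  obtains k i j where "x = (k, i)" "y = (Suc k, j)" "x \<in> carrier"
    "S k i \<le> j" "j \<le> S k i + (b - 1)"
proof -
  obtain k i where x: "x = (k, i)" by (cases x)
  have xc: "x \<in> carrier" "le x y" "x \<noteq> y" using assms by (auto simp: covers_def ord_def)
  obtain m j where y: "y = (k + m, j)" using xc(2) x le_E by blast
  have "m \<noteq> 0" using xc le_same_rank[of x y] x y by auto
  then obtain p where p: "m = 1 + p" by (cases m) auto
  obtain l where l: "le (k, i) (k + 1, l)" "le (k + 1, l) (k + 1 + p, j)"
    using xc(2) le_intermediate[of k i 1 p j] x y p by auto
  have "(x, (k + 1, l)) \<in> ord" "((k + 1, l), y) \<in> ord" "(k + 1, l) \<noteq> x"
    using l xc x y p carrier_le by (auto simp: ord_def simp del: le_add)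
  then have "y = (k + 1, l)" using assms by (auto simp: covers_def)
  then show ?thesis using that[of k i l] x xc l(1) le_add[of k i 1 l] by auto
qed

lemma partial_order_ord: "partial_order_on carrier ord"
  unfolding partial_order_on_def preorder_on_def
  using carrier_le le_refl le_antisym
  by (auto simp: ord_def refl_on_def trans_def antisym_def intro: le_trans)

lemma ranked_ord: "ranked_poset carrier ord level"
  unfolding ranked_poset_def
proof (intro conjI allI impI)
  show "carrier = (\<Union>i. level i)"
    by (auto simp: level_def carrier_iff)
  show "disjoint_family level"
    by (auto simp: disjoint_family_on_def level_def)
next
  fix i x y assume "x \<in> level i \<and> covers ord y x"
  then have x: "x \<in> level i" and c: "covers ord y x" by auto
  then have "y \<in> carrier" by (auto simp: covers_def ord_def intro: carrier_le)
  with c x show "y \<in> level (Suc i)"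
    by (elim covers_E) (auto simp: level_def carrier_iff)
next
  fix i j x y assume "x \<in> level i \<and> y \<in> level j \<and> (x, y) \<in> ord \<and> x \<noteq> y"
  moreover from this have "fst x \<noteq> fst y" using le_same_rank[of x y] by (auto simp: ord_def)
  ultimately show "i < j" by (auto simp: level_def ord_def le_def)
qed (rule partial_order_ord)

section \<open>Every cone is a translate of the whole poset\<close>

text \<open>The labels strictly inside the interval of descendants of an element evolve exactly as
  those of the whole poset, because a child's labels depend only on labels inside the interval.\<close>

lemma descendants_translate:
  "hi k i m = lo k i m + hi 0 0 m \<and> (\<forall>t<hi 0 0 m. w (k + m) (lo k i m + t) = w m t)"
proof (induction m)
  case (Suc m)
  let ?L = "lo k i m" and ?H = "hi 0 0 m"
  have lab: "w (k + m) (?L + t) = w m t" if "t < ?H" for t using Suc that by blast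
  then have len_eq: "len (k + m) (?L + t) = len m t" if "t < ?H" for t
    using that by (simp add: child_count_def)
  have S: "S (k + m) (?L + t) = S (k + m) ?L + S m t" if "t \<le> ?H" for t
    using that by (induction t) (auto simp: S_Suc len_eq)
  have "w (Suc (k + m)) (S (k + m) ?L + p) = w (Suc m) p" if p: "p < S m ?H + (b - 1)" for p
  proof -
    obtain u v where uv: "p = S m u + v" "v < len m u" using split_index by blast
    have "u \<le> ?H"
    proof (rule ccontr)
      assume "\<not> u \<le> ?H"
      then have "S m (Suc ?H) \<le> S m u" by (intro S_mono) simp
      then show False using p uv len_ge[of m ?H] by (simp add: S_Suc)
    qed
    then have eq: "S (k + m) ?L + p = S (k + m) (?L + u) + v" using uv S by simp
    show ?thesis
    proof (cases "u < ?H")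
      case True
      then show ?thesis using uv len_eq lab row_Suc_child[of v "k + m" "?L + u"] row_Suc_child[of v m u]
        unfolding eq by (simp del: row.simps)
    next
      case False
      \<comment> \<open>The right gap of the last descendant may depend on the outside, but only
        sibling gaps of its children lie inside the interval, and these carry the fixed labels
        \<open>e v\<close>.\<close>
      then have "v < b - 1" using p uv \<open>u \<le> ?H\<close> by simp
      moreover from this have "v < len (k + m) (?L + u)" using len_ge[of "k + m" "?L + u"] by linarith
      ultimately show ?thesis using uv row_Suc_child[of v "k + m" "?L + u"] row_Suc_child[of v m u]
        unfolding eq by (simp del: row.simps)
    qed
  qed
  then show ?case using S[of ?H] Suc by (simp del: row.simps)
qed simp

lemma S_translate:
  assumes "t \<le> hi 0 0 m"
  shows "S (k + m) (lo k i m + t) = lo k i (Suc m) + S m t"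
  using assms
proof (induction t)
  case (Suc t)
  then show ?case
    using descendants_translate[of k i m] by (simp add: S_Suc child_count_def)
qed simp

lemma hi_le_root: "t \<le> hi 0 0 m \<Longrightarrow> hi m t p \<le> hi 0 0 (m + p)"
  by (simp add: hi_add hi_mono)

lemma lo_translate:
  assumes "t \<le> hi 0 0 m"
  shows "lo (k + m) (lo k i m + t) p = lo k i (m + p) + lo m t p"
proof (induction p)
  case (Suc p)
  have "lo m t p \<le> hi 0 0 (m + p)"
    using hi_le_root[OF assms, of p] lo_le_hi[of m t p] by linarith
  then show ?case using Suc S_translate[of "lo m t p" "m + p" k i] by (simp add: add.assoc)
qed simp

lemma hi_translate:
  assumes "t \<le> hi 0 0 m"
  shows "hi (k + m) (lo k i m + t) p = lo k i (m + p) + hi m t p"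
proof (induction p)
  case (Suc p)
  then show ?case
    using hi_le_root[OF assms, of p] S_translate[of "hi m t p" "m + p" k i] by (simp add: add.assoc)
qed simp

text \<open>The translation that carries the left boundary of the root cone, index 0 in every row,
  to the left boundary of the cone above \<open>(k, i)\<close>.\<close>

definition shift :: "nat \<Rightarrow> nat \<Rightarrow> nat \<times> nat \<Rightarrow> nat \<times> nat" where
  "shift k i x = (k + fst x, lo k i (fst x) + snd x)"

lemma le_shift:
  assumes "x \<in> carrier"
  shows "le (shift k i x) (shift k i y) \<longleftrightarrow> le x y"
proof (cases "fst x \<le> fst y")
  case True
  obtain m t where x: "x = (m, t)" by (cases x)
  obtain p u where y: "y = (m + p, u)" using True x by (cases y) (auto simp: le_iff_add)
  have t: "t \<le> hi 0 0 m" using assms x carrier_iff by simp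
  show ?thesis
    unfolding x y shift_def fst_conv snd_conv add.assoc[symmetric] le_add
      lo_translate[OF t] hi_translate[OF t]
    by auto
next
  case False
  then show ?thesis by (auto simp: le_def shift_def)
qed

lemma shift_bij: "bij_betw (shift k i) carrier {y. le (k, i) y}"
proof (rule bij_betw_imageI)
  show "inj_on (shift k i) carrier"
    by (auto simp: inj_on_def shift_def prod_eq_iff)
  show "shift k i ` carrier = {y. le (k, i) y}"
  proof (intro equalityI subsetI)
    fix y assume "y \<in> shift k i ` carrier"
    then show "y \<in> {y. le (k, i) y}"
      using descendants_translate[of k i] by (auto simp: shift_def carrier_iff)
  next
    fix y assume "y \<in> {y. le (k, i) y}"
    then obtain m j where y: "y = (k + m, j)" "lo k i m \<le> j" "j \<le> hi k i m"
      using le_E by blast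
    then have "y = shift k i (m, j - lo k i m)" "(m, j - lo k i m) \<in> carrier"
      using descendants_translate[of k i m] by (auto simp: shift_def carrier_iff)
    then show "y \<in> shift k i ` carrier" by blast
  qed
qed

lemma upho_ord: "upho carrier ord level"
  unfolding upho_def
proof (intro conjI ballI)
  show "finite_type level" by (simp add: finite_type_def level_def)
  fix s assume s: "s \<in> carrier"
  obtain k i where ki: "s = (k, i)" by (cases s)
  \<comment> \<open>\<open>shift\<close> runs from the whole poset to the filter; the isomorphism is
    required in the other direction.\<close>
  let ?f = "inv_into carrier (shift k i)"
  have ab: "above ord s = {y. le (k, i) y}" using s ki by (auto simp: above_def ord_def)
  have bij: "bij_betw ?f (above ord s) carrier"
    unfolding ab by (rule bij_betw_inv_into[OF shift_bij])
  have inv: "?f x \<in> carrier" "shift k i (?f x) = x" if "x \<in> above ord s" for x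
    using that bij_betw_inv_into_right[OF shift_bij] bij ab by (auto simp: bij_betw_def)
  have "(x, y) \<in> Restr ord (above ord s) \<longleftrightarrow> (?f x, ?f y) \<in> ord"
    if "x \<in> above ord s" "y \<in> above ord s" for x y
  proof -
    have "x \<in> carrier" using that(1) ab ki s carrier_le by blast
    then show ?thesis using that inv le_shift[OF inv(1), of x k i "?f y"] by (auto simp: ord_def)
  qed
  with bij show "poset_isomorphic (above ord s) (Restr ord (above ord s)) carrier ord"
    unfolding poset_isomorphic_def by blast
qed (rule ranked_ord)


section \<open>Straight-line drawing\<close>

definition pos :: "nat \<times> nat \<Rightarrow> real \<times> real" where
  "pos x = (real (snd x), real (fst x))"

lemma mem_edgeE:
  assumes "z \<in> closed_segment (pos (k, i)) (pos (Suc k, j))"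
  obtains u where "0 \<le> u" "u \<le> 1" "snd z = real k + u" "fst z = (1 - u) * real i + u * real j"
proof -
  obtain u where u: "0 \<le> u" "u \<le> 1" "z = (1 - u) *\<^sub>R pos (k, i) + u *\<^sub>R pos (Suc k, j)"
    using assms unfolding closed_segment_def by blast
  then have "snd z = real k + u" "fst z = (1 - u) * real i + u * real j"
    by (auto simp: pos_def algebra_simps)
  then show ?thesis using that u by blast
qed

text \<open>At equal ranks the horizontal distance of the edges is a convex combination of two
  nonnegative distances, not both zero, so it vanishes only at a common endpoint. At different ranks
  the strips share at most one line of vertices.\<close>

lemma edges_meet:
  assumes z: "z \<in> closed_segment (pos (k, i)) (pos (Suc k, j))"
      "z \<in> closed_segment (pos (k', i')) (pos (Suc k', j'))"
    and o: "k < k' \<or> k = k' \<and> i \<le> i' \<and> j \<le> j' \<and> (i, j) \<noteq> (i', j')"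
  shows "z \<in> {pos (k, i), pos (Suc k, j)} \<inter> {pos (k', i'), pos (Suc k', j')}"
proof -
  obtain u where u: "0 \<le> u" "u \<le> 1" "snd z = real k + u"
    "fst z = (1 - u) * real i + u * real j" using mem_edgeE[OF z(1)] by blast
  obtain v where v: "0 \<le> v" "v \<le> 1" "snd z = real k' + v"
    "fst z = (1 - v) * real i' + v * real j'" using mem_edgeE[OF z(2)] by blast
  show ?thesis
  proof (cases "k < k'")
    case True
    then have "real k + 1 \<le> real k'" by linarith
    then have "u = 1" "v = 0" using u v by linarith+
    then show ?thesis using u v by (auto simp: pos_def prod_eq_iff)
  next
    case False
    then have k: "k = k'" and le: "i \<le> i'" "j \<le> j'" "(i, j) \<noteq> (i', j')" using o by auto
    then have uv: "v = u" using u v by simp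
    have "(1 - u) * (real i' - real i) + u * (real j' - real j) = 0"
      using u(4) v(4) uv by (simp add: algebra_simps)
    moreover have "(1 - u) * (real i' - real i) \<ge> 0" "u * (real j' - real j) \<ge> 0"
      using u le by auto
    ultimately have "(1 - u) * (real i' - real i) = 0" "u * (real j' - real j) = 0"
      by linarith+
    then have "u = 1 \<and> j = j' \<or> u = 0 \<and> i = i'" using le(3) by auto
    then show ?thesis using u v uv k by (auto simp: pos_def prod_eq_iff)
  qed
qed

lemma planar_ord: "planar carrier ord level"
  unfolding planar_def
proof (intro exI[of _ pos] conjI allI impI ballI)
  show "inj_on pos carrier" by (auto simp: inj_on_def pos_def)
  show "snd (pos x) = real i" if "x \<in> level i" for i x
    using that by (auto simp: level_def pos_def)
next
  fix x y x' y'
  assume A: "covers ord y x \<and> covers ord y' x' \<and> (x, y) \<noteq> (x', y')"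
  obtain k i j where 1: "x = (k, i)" "y = (Suc k, j)" "S k i \<le> j" "j \<le> S k i + (b - 1)"
    using A covers_E by metis
  obtain k' i' j' where 2: "x' = (k', i')" "y' = (Suc k', j')" "S k' i' \<le> j'" "j' \<le> S k' i' + (b - 1)"
    using A covers_E by metis
  \<comment> \<open>The last child of \<open>p\<close> never lies right of the first child of a
    later \<open>p'\<close>, with equality for a shared child. Hence edges leaving one row are
    weakly ordered at both ends.\<close>
  have mono: "q \<le> q'" if "p < p'" "q \<le> S l p + (b - 1)" "S l p' \<le> q'" for l p p' q q'
    using that S_mono[of "Suc p" p' l] len_ge[of l p] by (simp add: S_Suc)
  have "k < k' \<or> k = k' \<and> i \<le> i' \<and> j \<le> j' \<and> (i, j) \<noteq> (i', j') \<or>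
        k' < k \<or> k' = k \<and> i' \<le> i \<and> j' \<le> j \<and> (i', j') \<noteq> (i, j)"
  proof -
    have ne: "k = k' \<Longrightarrow> (i, j) \<noteq> (i', j')" using A unfolding 1(1,2) 2(1,2) by auto
    consider "k \<noteq> k'" | "k = k'" "i < i'" | "k = k'" "i' < i" | "k = k'" "i = i'" by linarith
    then show ?thesis
    proof cases
      case 2
      then show ?thesis using mono[of i i' j k j'] 1(4) \<open>S k' i' \<le> j'\<close> by simp
    next
      case 3
      then show ?thesis using mono[of i' i j' k j] 1(3) \<open>j' \<le> S k' i' + (b - 1)\<close> by simp
    next
      case 4
      then show ?thesis using ne by auto
    qed auto
  qed
  then show "closed_segment (pos x) (pos y) \<inter> closed_segment (pos x') (pos y')
             \<subseteq> {pos x, pos y} \<inter> {pos x', pos y'}"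
    unfolding 1(1,2) 2(1,2)
    by (intro subsetI, elim IntE disjE)
      (metis edges_meet Int_commute)+
qed

section \<open>Counting gaps by label\<close>

definition initial_count :: "nat \<Rightarrow> nat" where
  "initial_count q = (\<Sum>v<b - 1. of_bool (e v = q))"

definition label_count :: "nat \<Rightarrow> nat \<Rightarrow> nat" where
  "label_count m q = (\<Sum>j<hi 0 0 m. of_bool (w m j = q))"

lemma sum_add_split: "(\<Sum>j<m + n. f j) = (\<Sum>j<m. f j) + (\<Sum>j<n. f (m + j))"
  for f :: "nat \<Rightarrow> nat"
  by (induction n) auto

lemma sum_initial:
  "(\<Sum>v<b - 1. of_bool (w (Suc k) (S k i + v) = q)) = initial_count q"
  unfolding initial_count_def
proof (intro sum.cong refl)
  fix v assume "v \<in> {..<b - 1}"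
  then have v: "v < b - 1" by simp
  then have "v < len k i" using len_ge[of k i] by linarith
  then show "of_bool (w (Suc k) (S k i + v) = q) = of_bool (e v = q)"
    using v by (simp add: row_Suc_child del: row.simps)
qed

text \<open>Besides the sibling gaps there is at most the inherited gap, which carries
  \<open>q\<close> iff its label was \<open>Suc q\<close>. A label 1 leaves no inherited gap, in
  accordance with \<open>Suc q\<close> > 1.\<close>

lemma sum_children:
  assumes "q \<ge> 1"
  shows "(\<Sum>v<len k i. of_bool (w (Suc k) (S k i + v) = q))
           = initial_count q + of_bool (w k i = Suc q)"
proof (cases "w k i = 1")
  case True
  then show ?thesis using assms sum_initial[of k i q] by (simp add: child_count_def del: row.simps)
next
  case False
  then have len: "len k i = Suc (b - 1)" using b_pos by (simp add: child_count_def)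
  have "w (Suc k) (S k i + (b - 1)) = w k i - 1"
    using len by (subst row_Suc_child) auto
  then show ?thesis
    using sum_initial[of k i q] assms False unfolding len sum.lessThan_Suc
    by (auto simp del: row.simps)
qed

lemma sum_row_Suc:
  assumes "q \<ge> 1"
  shows "(\<Sum>j<S k u. of_bool (w (Suc k) j = q))
           = initial_count q * u + (\<Sum>i<u. of_bool (w k i = Suc q))"
proof (induction u)
  case (Suc u)
  then show ?case
    using sum_children[OF assms, of k u] by (simp add: S_Suc sum_add_split del: row.simps)
qed simp

lemma label_count_Suc:
  assumes "q \<ge> 1"
  shows "label_count (Suc m) q = initial_count q * Suc (hi 0 0 m) + label_count m (Suc q)"
  using sum_row_Suc[OF assms, of m "hi 0 0 m"] sum_initial[of m "hi 0 0 m" q]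
  by (simp add: label_count_def sum_add_split del: row.simps)

text \<open>A gap labelled \<open>q\<close> in row \<open>m\<close> began \<open>p\<close> rows
  earlier as a sibling gap labelled \<open>q + p\<close>, whose parent lies in row
  \<open>m - Suc p\<close>.\<close>

lemma label_count_eq:
  assumes "q \<ge> 1"
  shows "label_count m q = (\<Sum>p<m. initial_count (q + p) * Suc (hi 0 0 (m - Suc p)))"
  using assms
proof (induction m arbitrary: q)
  case 0
  then show ?case by (simp add: label_count_def)
next
  case (Suc m)
  then show ?case
    by (simp add: label_count_Suc sum.lessThan_Suc_shift del: hi.simps sum.lessThan_Suc)
qed

lemma S_plus_merges: "S k u + (\<Sum>i<u. of_bool (w k i = 1)) = b * u"
  using b_pos by (induction u) (auto simp: S_Suc child_count_def)

text \<open>Each point has \<open>b\<close> children, and every gap labelled 1 identifies two of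
  them; \<open>label_count_eq\<close> with \<open>q\<close> = 1 traces these gaps back to their
  origin.\<close>

lemma size_recurrence:
  "Suc (hi 0 0 (Suc m)) + (\<Sum>p<m. initial_count (Suc p) * Suc (hi 0 0 (m - Suc p)))
     = b * Suc (hi 0 0 m)"
  using S_plus_merges[of m "hi 0 0 m"] label_count_eq[of 1 m] b_pos
  by (simp add: label_count_def)

lemma card_level: "card (level m) = Suc (hi 0 0 m)"
  by (simp add: level_def)

end

section \<open>Transport from pairs to natural numbers\<close>

lemma covers_inv_image:
  assumes "bij g"
  shows "covers (inv_image r g) y x \<longleftrightarrow> covers r (g y) (g x)"
proof -
  have "(\<exists>z. R (g z)) \<longleftrightarrow> (\<exists>z. R z)" for R using assms by (metis bij_pointE)
  from this[of "\<lambda>z. (g x, z) \<in> r \<and> (z, g y) \<in> r \<and> z \<noteq> g x \<and> z \<noteq> g y"]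
  show ?thesis using assms by (simp add: covers_def in_inv_image inj_eq bij_is_inj)
qed

lemma ranked_poset_vimage:
  assumes "bij g" "ranked_poset P r R"
  shows "ranked_poset (g -` P) (inv_image r g) (\<lambda>i. g -` R i)"
proof -
  have inj: "g x = g y \<longleftrightarrow> x = y" for x y using assms(1) by (simp add: bij_is_inj inj_eq)
  have po: "partial_order_on P r" and un: "P = (\<Union>i. R i)" and dis: "disjoint_family R"
    and cov: "\<And>i x y. x \<in> R i \<and> covers r y x \<Longrightarrow> y \<in> R (Suc i)"
    and mon: "\<And>i j x y. x \<in> R i \<and> y \<in> R j \<and> (x, y) \<in> r \<and> x \<noteq> y \<Longrightarrow> i < j"
    using assms(2) unfolding ranked_poset_def by blast+
  from po have "refl_on P r" "r \<subseteq> P \<times> P" "trans r" "antisym r"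
    by (auto simp: partial_order_on_def preorder_on_def)
  then have "partial_order_on (g -` P) (inv_image r g)"
    unfolding partial_order_on_def preorder_on_def
    by (auto simp: refl_on_def antisym_def in_inv_image trans_inv_image) (metis inj)
  moreover have "disjoint_family (\<lambda>i. g -` R i)"
    using dis by (auto simp: disjoint_family_on_def)
  moreover have "g -` P = (\<Union>i. g -` R i)"
    using un by auto
  ultimately show ?thesis
    unfolding ranked_poset_def covers_inv_image[OF assms(1)] in_inv_image vimage_eq
    using cov mon inj by metis
qed

lemma upho_vimage:
  assumes g: "bij g" and "upho P r R"
  shows "upho (g -` P) (inv_image r g) (\<lambda>i. g -` R i)"
  unfolding upho_def
proof (intro conjI ballI)
  show "ranked_poset (g -` P) (inv_image r g) (\<lambda>i. g -` R i)"
    using assms by (simp add: upho_def ranked_poset_vimage)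
  show "finite_type (\<lambda>i. g -` R i)"
    using assms by (simp add: upho_def finite_type_def finite_vimageI bij_is_inj)
next
  fix s assume "s \<in> g -` P"
  then obtain f where f: "bij_betw f (above r (g s)) P"
    and iso: "\<And>x y. x \<in> above r (g s) \<Longrightarrow> y \<in> above r (g s) \<Longrightarrow>
      (x, y) \<in> Restr r (above r (g s)) \<longleftrightarrow> (f x, f y) \<in> r"
    using assms unfolding upho_def poset_isomorphic_def vimage_eq by metis
  have ab: "above (inv_image r g) s = g -` above r (g s)"
    by (auto simp: above_def)
  have vb: "bij_betw g (g -` A) A" for A
    using g by (auto simp: bij_betw_def surj_image_vimage_eq intro: inj_on_subset)
  have "bij_betw (inv g \<circ> f \<circ> g) (above (inv_image r g) s) (g -` P)"
  proof -
    have "bij_betw (inv g) P (g -` P)"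
      using g by (auto simp: bij_betw_def bij_vimage_eq_inv_image inj_on_inv_into)
    then show ?thesis unfolding ab using vb f by (intro bij_betw_trans)
  qed
  moreover have "(x, y) \<in> Restr (inv_image r g) (above (inv_image r g) s) \<longleftrightarrow>
      ((inv g \<circ> f \<circ> g) x, (inv g \<circ> f \<circ> g) y) \<in> inv_image r g"
    if "x \<in> above (inv_image r g) s" "y \<in> above (inv_image r g) s" for x y
    using that iso[of "g x" "g y"] g unfolding ab by (simp add: bij_is_surj surj_f_inv_f)
  ultimately show "poset_isomorphic (above (inv_image r g) s)
      (Restr (inv_image r g) (above (inv_image r g) s)) (g -` P) (inv_image r g)"
    unfolding poset_isomorphic_def by blast
qed

lemma planar_vimage:
  assumes g: "bij g" and "planar P r R"
  shows "planar (g -` P) (inv_image r g) (\<lambda>i. g -` R i)"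
proof -
  obtain pos :: "_ \<Rightarrow> real \<times> real"
    where pos: "inj_on pos P" "\<forall>i. \<forall>x\<in>R i. snd (pos x) = real i"
    and cr: "\<forall>x y x' y'. covers r y x \<and> covers r y' x' \<and> (x, y) \<noteq> (x', y') \<longrightarrow>
           closed_segment (pos x) (pos y) \<inter> closed_segment (pos x') (pos y')
             \<subseteq> {pos x, pos y} \<inter> {pos x', pos y'}"
    using assms(2) unfolding planar_def by (elim exE conjE) (rule that, assumption+)
  have inj: "g x = g y \<longleftrightarrow> x = y" for x y using g by (simp add: bij_is_inj inj_eq)
  show ?thesis
    unfolding planar_def
  proof (intro exI[of _ "pos \<circ> g"] conjI allI impI ballI)
    show "inj_on (pos \<circ> g) (g -` P)" using pos(1) by (intro comp_inj_on) (auto simp: inj_on_def inj)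
  next
    fix x y x' y'
    assume "covers (inv_image r g) y x \<and> covers (inv_image r g) y' x' \<and> (x, y) \<noteq> (x', y')"
    then show "closed_segment ((pos \<circ> g) x) ((pos \<circ> g) y) \<inter>
        closed_segment ((pos \<circ> g) x') ((pos \<circ> g) y')
        \<subseteq> {(pos \<circ> g) x, (pos \<circ> g) y} \<inter> {(pos \<circ> g) x', (pos \<circ> g) y'}"
      unfolding comp_def by (intro cr[rule_format]) (simp add: covers_inv_image[OF g] inj)
  qed (use pos(2) in simp)
qed

lemma rank_gf_vimage: "bij g \<Longrightarrow> rank_gf (\<lambda>i. g -` R i) = rank_gf R"
  by (simp add: rank_gf_def card_vimage_inj bij_is_inj bij_is_surj)

section \<open>Choice of labels and the generating function\<close>

lemma ex_prescribed_counts: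
  fixes c :: "nat \<Rightarrow> nat"
  assumes "(\<Sum>q=1..n. c q) \<le> B"
  shows "\<exists>e. \<forall>q\<ge>1. (\<Sum>v<B. of_bool (e v = q)) = (if q \<le> n then c q else 0)"
proof -
  have "\<exists>xs. length xs = (\<Sum>q=1..n. c q) \<and>
          (\<forall>q\<ge>1. length (filter (\<lambda>x. x = q) xs) = (if q \<le> n then c q else 0))"
  proof (induction n)
    case 0
    then show ?case by (intro exI[of _ "[]"]) simp
  next
    case (Suc n)
    then obtain xs where "length xs = (\<Sum>q=1..n. c q)"
      "\<forall>q\<ge>1. length (filter (\<lambda>x. x = q) xs) = (if q \<le> n then c q else 0)" by blast
    then show ?case
      by (intro exI[of _ "xs @ replicate (c (Suc n)) (Suc n)"]) (auto simp: le_Suc_eq)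
  qed
  then obtain xs where xs: "length xs = (\<Sum>q=1..n. c q)"
    "\<And>q. q \<ge> 1 \<Longrightarrow> length (filter (\<lambda>x. x = q) xs) = (if q \<le> n then c q else 0)" by blast
  \<comment> \<open>The padding 0 is the label of gaps that never close; it is not counted since
    \<open>q \<ge> 1\<close>.\<close>
  define ys where "ys = xs @ replicate (B - length xs) 0"
  have len: "length ys = B" using assms xs(1) by (simp add: ys_def)
  have "(\<Sum>v<B. of_bool (ys ! v = q)) = (if q \<le> n then c q else 0)" if "q \<ge> 1" for q
  proof -
    have "(\<Sum>v<B. of_bool (ys ! v = q)) = card {v. v < B \<and> ys ! v = q}"
      by (simp add: sum.If_cases of_bool_def Int_def)
    also have "\<dots> = length (filter (\<lambda>x. x = q) ys)"
      by (simp add: length_filter_conv_card len)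
    also have "\<dots> = length (filter (\<lambda>x. x = q) xs)" using that by (auto simp: ys_def)
    finally show ?thesis using xs(2) that by simp
  qed
  then show ?thesis by (intro exI[of _ "\<lambda>v. ys ! v"]) blast
qed

theorem theorem4p9:
  fixes b n :: nat and a :: "nat \<Rightarrow> nat" and Q :: "rat poly"
  assumes "Q = 1 - monom (of_nat b) 1 + (\<Sum>i=2..n. monom (of_nat (a i)) i)"
    and "poly Q 1 \<le> 0"
  shows "\<exists>(P :: nat set) r R.
           upho P r R \<and> planar P r R \<and> rank_gf R = inverse (fps_of_poly Q)"
proof -
  have "poly Q 1 = 1 - of_nat b + of_nat (\<Sum>i=2..n. a i)"
    by (simp add: assms(1) poly_sum poly_monom)
  with assms(2) have "of_nat (1 + (\<Sum>i=2..n. a i)) \<le> (of_nat b :: rat)" by simp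
  \<comment> \<open>This is the meaning of Q(1) \<le> 0: the \<open>b - 1\<close> sibling gaps
    suffice for all positive labels.\<close>
  then have sum_le: "1 + (\<Sum>i=2..n. a i) \<le> b" unfolding of_nat_le_iff .
  have "(\<Sum>q=1..n-1. a (Suc q)) = (\<Sum>i=2..n. a i)"
    using sum.shift_bounds_cl_Suc_ivl[of a 1 "n - 1"] by (cases n) (auto simp: numeral_2_eq_2)
  with sum_le have "(\<Sum>q=1..n-1. a (Suc q)) \<le> b - 1" by simp
  \<comment> \<open>Siblings lie one rank above their parent, so a merger \<open>i\<close> ranks
    above the parent needs the label \<open>i - 1\<close>.\<close>
  then obtain e where e: "\<And>q. q \<ge> 1 \<Longrightarrow>
      (\<Sum>v<b - 1. of_bool (e v = q)) = (if q \<le> n - 1 then a (Suc q) else 0)"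
    using ex_prescribed_counts[of "\<lambda>q. a (Suc q)" "n - 1" "b - 1"] by blast
  interpret gap_rows b e using sum_le by unfold_locales simp
  have coeff_Q: "coeff Q 0 = 1" "coeff Q (Suc 0) = - of_nat b"
    "\<And>p. coeff Q (Suc (Suc p)) = of_nat (initial_count (Suc p))"
    using e by (auto simp: assms(1) coeff_sum initial_count_def)
  have "fps_of_poly Q * rank_gf level = 1"
  proof (rule fps_ext)
    fix m
    show "(fps_of_poly Q * rank_gf level) $ m = 1 $ m"
    proof (cases m)
      case 0
      then show ?thesis by (simp add: coeff_Q rank_gf_def card_level)
    next
      case (Suc k)
      have "(fps_of_poly Q * rank_gf level) $ m
          = (\<Sum>i<Suc (Suc k). coeff Q i * of_nat (card (level (Suc k - i))))"
        by (simp add: Suc fps_mult_nth rank_gf_def atLeast0AtMost lessThan_Suc_atMost)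
      \<comment> \<open>Splitting off the first two terms shifts the index by two and leaves the sum
        of \<open>size_recurrence\<close>.\<close>
      also have "\<dots> = of_nat (Suc (hi 0 0 (Suc k))) - of_nat b * of_nat (Suc (hi 0 0 k))
          + (\<Sum>p<k. of_nat (initial_count (Suc p)) * of_nat (Suc (hi 0 0 (k - Suc p))))"
        by (simp add: sum.lessThan_Suc_shift coeff_Q card_level del: hi.simps sum.lessThan_Suc)
      also have "\<dots> = of_nat (Suc (hi 0 0 (Suc k))
            + (\<Sum>p<k. initial_count (Suc p) * Suc (hi 0 0 (k - Suc p))))
            - of_nat (b * Suc (hi 0 0 k))"
        by (simp only: of_nat_add of_nat_sum of_nat_mult diff_add_eq)
      also have "\<dots> = 0" unfolding size_recurrence by simp
      finally show ?thesis by (simp add: Suc)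
    qed
  qed
  then have gf: "rank_gf level = inverse (fps_of_poly Q)"
    by (rule fps_inverse_unique[symmetric])
  show ?thesis
    using upho_vimage[OF bij_prod_decode upho_ord] planar_vimage[OF bij_prod_decode planar_ord]
      rank_gf_vimage[OF bij_prod_decode, of level] gf by (intro exI conjI) simp_all
qed

end
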